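(* Let $\Gamma=(V_\Gamma,T_\Gamma,\mathbf{s},\mathbf{r})$ and $\Delta=(V_\Delta,T_\Delta,\mathbf{s},\mathbf{r})$ be two networks. Then $\Gamma\cong\Delta$ (as networks) if and only if $Q_\Gamma\cong Q_\Delta$ (as semigroups).
   Context: A network $\Gamma=(V,T,\mathbf{s},\mathbf{r})$ consists of a set $V$ of vertices, a set $T$ of relations, and maps $\mathbf{s},\mathbf{r}:T\to\mathcal{P}(V)$ such that for every $t\in T$ the sets $\mathbf{s}(t)$ and $\mathbf{r}(t)$ are disjoint non-empty subsets of $V$; $V$ and $T$ are finite or countably infinite. A vertex $v$ is identified with the singleton $\{v\}$. Put $T^0=\{A\subseteq V: A=\mathbf{s}(t)\text{ or }A=\mathbf{r}(t)\text{ for some }t\in T\}\cup V$, and set $\mathbf{s}(A)=A=\mathbf{r}(A)$ for $A\in T^0$. For each $t\in T$ let $t^{-1}$ be a formal symbol with $\mathbf{s}(t^{-1})=\mathbf{r}(t)$, $\mathbf{r}(t^{-1})=\mathbf{s}(t)$; put $A^{-1}=A$ for $A\in T^0$ and $T^{-1}=\{t^{-1}:t\in T\}$. The symbol sets $T$, $T^0$, $T^{-1}$, $\{0\}$ are pairwise disjoint. $Q_\Gamma$ is the semigroup generated by $X=T\cup T^0\cup T^{-1}\cup\{0\}$ subject to the relations: (NR1) $\mathbf{s}(t)t=t=t\mathbf{r}(t)$ for $t\in T\cup T^0\cup T^{-1}$; (NR2) $t_1t_2=0$ if $\mathbf{r}(t_1)\cap\mathbf{s}(t_2)=\emptyset$,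 for $t_1,t_2\in T\cup T^0\cup T^{-1}$; (NR3) $t_1^{-1}t_2=0$ if $t_1\neq t_2$, for $t_1,t_2\in T$; (NR4) $t^{-1}t=\mathbf{r}(t)$ for $t\in T$; (NR5) $t^{-1}A=0$ if $\mathbf{s}(t)\neq A$, for $t\in T$, $A\in T^0$; (NR6) $0x=0=x0$ for all $x\in X$. A network homomorphism $\phi=(\phi_V,\phi_T)$ from $\Gamma$ to $\Delta$ consists of maps $\phi_V:V_\Gamma\to V_\Delta$ and $\phi_T:T_\Gamma\to T_\Delta$ such that for all $t\in T_\Gamma$, $\{v\phi_V:v\in\mathbf{s}(t)\}=\mathbf{s}(t\phi_T)$ and $\{v\phi_V:v\in\mathbf{r}(t)\}=\mathbf{r}(t\phi_T)$. It is an isomorphism if $\phi_V$ and $\phi_T$ are bijective; $\Gamma\cong\Delta$ means an isomorphism exists. *)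

theory Defs
  imports "HOL-Algebra.Group" "HOL-Library.Countable_Set"
begin

record ('v, 't) network_data =
  verts :: "'v set"
  rels :: "'t set"
  src :: "'t \<Rightarrow> 'v set"
  rng :: "'t \<Rightarrow> 'v set"

locale network =
  fixes \<Gamma> :: "('v, 't) network_data"
  assumes countable_verts: "countable (verts \<Gamma>)"
    and countable_rels: "countable (rels \<Gamma>)"
    and src_subset: "t \<in> rels \<Gamma> \<Longrightarrow> src \<Gamma> t \<subseteq> verts \<Gamma>"
    and rng_subset: "t \<in> rels \<Gamma> \<Longrightarrow> rng \<Gamma> t \<subseteq> verts \<Gamma>"
    and src_nonempty: "t \<in> rels \<Gamma> \<Longrightarrow> src \<Gamma> t \<noteq> {}"
    and rng_nonempty: "t \<in> rels \<Gamma> \<Longrightarrow> rng \<Gamma> t \<noteq> {}"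
    and src_rng_disjoint: "t \<in> rels \<Gamma> \<Longrightarrow> src \<Gamma> t \<inter> rng \<Gamma> t = {}"

definition network_hom ::
  "('v, 't) network_data \<Rightarrow> ('w, 'u) network_data \<Rightarrow> ('v \<Rightarrow> 'w) \<Rightarrow> ('t \<Rightarrow> 'u) \<Rightarrow> bool" where
  "network_hom \<Gamma> \<Delta> f g \<longleftrightarrow>
     f \<in> verts \<Gamma> \<rightarrow> verts \<Delta> \<and> g \<in> rels \<Gamma> \<rightarrow> rels \<Delta> \<and>
     (\<forall>t\<in>rels \<Gamma>. f ` src \<Gamma> t = src \<Delta> (g t) \<and> f ` rng \<Gamma> t = rng \<Delta> (g t))"

definition network_isomorphic ::
  "('v, 't) network_data \<Rightarrow> ('w, 'u) network_data \<Rightarrow> bool" where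
  "network_isomorphic \<Gamma> \<Delta> \<longleftrightarrow>
     (\<exists>f g. network_hom \<Gamma> \<Delta> f g \<and>
        bij_betw f (verts \<Gamma>) (verts \<Delta>) \<and> bij_betw g (rels \<Gamma>) (rels \<Delta>))"

text \<open>A vertex is identified with the corresponding singleton, so the vertices enter
  \<open>T\<^sup>0\<close> as one-element sets.\<close>

definition rels0 :: "('v, 't) network_data \<Rightarrow> 'v set set" where
  "rels0 \<Gamma> = src \<Gamma> ` rels \<Gamma> \<union> rng \<Gamma> ` rels \<Gamma> \<union> (\<lambda>v. {v}) ` verts \<Gamma>"

datatype ('v, 't) symb = Rel 't | Obj "'v set" | Inv 't | Zero

text \<open>The maps \<open>\<^bold>s\<close> and \<open>\<^bold>r\<close> extended to \<open>T \<union> T\<^sup>0 \<union> T\<inverse>\<close>; the values at \<open>Zero\<close>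
  are never used.\<close>

primrec symb_src :: "('v, 't) network_data \<Rightarrow> ('v, 't) symb \<Rightarrow> 'v set" where
  "symb_src \<Gamma> (Rel t) = src \<Gamma> t"
| "symb_src \<Gamma> (Obj A) = A"
| "symb_src \<Gamma> (Inv t) = rng \<Gamma> t"
| "symb_src \<Gamma> Zero = undefined"

primrec symb_rng :: "('v, 't) network_data \<Rightarrow> ('v, 't) symb \<Rightarrow> 'v set" where
  "symb_rng \<Gamma> (Rel t) = rng \<Gamma> t"
| "symb_rng \<Gamma> (Obj A) = A"
| "symb_rng \<Gamma> (Inv t) = src \<Gamma> t"
| "symb_rng \<Gamma> Zero = undefined"

definition nz_gens :: "('v, 't) network_data \<Rightarrow> ('v, 't) symb set" where
  "nz_gens \<Gamma> = Rel ` rels \<Gamma> \<union> Obj ` rels0 \<Gamma> \<union> Inv ` rels \<Gamma>"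

definition gens :: "('v, 't) network_data \<Rightarrow> ('v, 't) symb set" where
  "gens \<Gamma> = nz_gens \<Gamma> \<union> {Zero}"

text \<open>The free semigroup on the generators consists of the nonempty words.\<close>

definition gen_words :: "('v, 't) network_data \<Rightarrow> ('v, 't) symb list set" where
  "gen_words \<Gamma> = lists (gens \<Gamma>) - {[]}"

inductive network_rel ::
  "('v, 't) network_data \<Rightarrow> ('v, 't) symb list \<Rightarrow> ('v, 't) symb list \<Rightarrow> bool"
  for \<Gamma> where
  NR1_left: "x \<in> nz_gens \<Gamma> \<Longrightarrow> network_rel \<Gamma> [Obj (symb_src \<Gamma> x), x] [x]"
| NR1_right: "x \<in> nz_gens \<Gamma> \<Longrightarrow> network_rel \<Gamma> [x, Obj (symb_rng \<Gamma> x)] [x]"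
| NR2: "\<lbrakk>x \<in> nz_gens \<Gamma>; y \<in> nz_gens \<Gamma>; symb_rng \<Gamma> x \<inter> symb_src \<Gamma> y = {}\<rbrakk>
    \<Longrightarrow> network_rel \<Gamma> [x, y] [Zero]"
| NR3: "\<lbrakk>t \<in> rels \<Gamma>; u \<in> rels \<Gamma>; t \<noteq> u\<rbrakk> \<Longrightarrow> network_rel \<Gamma> [Inv t, Rel u] [Zero]"
| NR4: "t \<in> rels \<Gamma> \<Longrightarrow> network_rel \<Gamma> [Inv t, Rel t] [Obj (rng \<Gamma> t)]"
| NR5: "\<lbrakk>t \<in> rels \<Gamma>; A \<in> rels0 \<Gamma>; src \<Gamma> t \<noteq> A\<rbrakk> \<Longrightarrow> network_rel \<Gamma> [Inv t, Obj A] [Zero]"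
| NR6_left: "x \<in> gens \<Gamma> \<Longrightarrow> network_rel \<Gamma> [Zero, x] [Zero]"
| NR6_right: "x \<in> gens \<Gamma> \<Longrightarrow> network_rel \<Gamma> [x, Zero] [Zero]"

text \<open>The congruence on the free semigroup generated by these relations.\<close>

inductive network_cong ::
  "('v, 't) network_data \<Rightarrow> ('v, 't) symb list \<Rightarrow> ('v, 't) symb list \<Rightarrow> bool"
  for \<Gamma> where
  base: "network_rel \<Gamma> a b \<Longrightarrow> network_cong \<Gamma> a b"
| refl: "a \<in> gen_words \<Gamma> \<Longrightarrow> network_cong \<Gamma> a a"
| sym: "network_cong \<Gamma> a b \<Longrightarrow> network_cong \<Gamma> b a"
| trans: "\<lbrakk>network_cong \<Gamma> a b; network_cong \<Gamma> b c\<rbrakk> \<Longrightarrow> network_cong \<Gamma> a c"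
| append: "\<lbrakk>network_cong \<Gamma> a b; network_cong \<Gamma> c d\<rbrakk> \<Longrightarrow> network_cong \<Gamma> (a @ c) (b @ d)"

definition cong_rel :: "('v, 't) network_data \<Rightarrow> ('v, 't) symb list rel" where
  "cong_rel \<Gamma> = {(a, b). network_cong \<Gamma> a b}"

text \<open>The algebra library has no structure for semigroups, so \<open>Q\<^sub>\<Gamma>\<close> is encoded in the monoid
  record with an unspecified \<open>one\<close>. The relation \<open>\<cong>\<close> of the library only uses
  \<open>carrier\<close> and \<open>mult\<close>, hence it is semigroup isomorphism here.\<close>

definition network_semigroup ::
  "('v, 't) network_data \<Rightarrow> ('v, 't) symb list set monoid" where
  "network_semigroup \<Gamma> =
     \<lparr>carrier = gen_words \<Gamma> // cong_rel \<Gamma>,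
      mult = (\<lambda>P R. \<Union>a\<in>P. \<Union>b\<in>R. cong_rel \<Gamma> `` {a @ b}),
      one = undefined\<rparr>"

lemma symb_src_rng_rels0:
  "x \<in> nz_gens \<Gamma> \<Longrightarrow> symb_src \<Gamma> x \<in> rels0 \<Gamma>"
  "x \<in> nz_gens \<Gamma> \<Longrightarrow> symb_rng \<Gamma> x \<in> rels0 \<Gamma>"
  by (auto simp: nz_gens_def rels0_def)

lemma network_rel_gen_words:
  "network_rel \<Gamma> a b \<Longrightarrow> a \<in> gen_words \<Gamma> \<and> b \<in> gen_words \<Gamma>"
  by (induction rule: network_rel.induct)
     (auto simp: gen_words_def gens_def dest: symb_src_rng_rels0,
      auto simp: nz_gens_def rels0_def)

lemma gen_words_append: "a \<in> gen_words \<Gamma> \<Longrightarrow> b \<in> gen_words \<Gamma> \<Longrightarrow> a @ b \<in> gen_words \<Gamma>"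
  by (auto simp: gen_words_def)

lemma network_cong_gen_words:
  "network_cong \<Gamma> a b \<Longrightarrow> a \<in> gen_words \<Gamma> \<and> b \<in> gen_words \<Gamma>"
  by (induction rule: network_cong.induct)
     (simp_all add: network_rel_gen_words gen_words_append)

lemma equiv_cong_rel: "equiv (gen_words \<Gamma>) (cong_rel \<Gamma>)"
proof (rule equivI)
  show "cong_rel \<Gamma> \<subseteq> gen_words \<Gamma> \<times> gen_words \<Gamma>"
    by (auto simp: cong_rel_def dest: network_cong_gen_words)
  show "refl_on (gen_words \<Gamma>) (cong_rel \<Gamma>)"
    by (simp add: cong_rel_def refl_on_def network_cong.refl)
  show "sym (cong_rel \<Gamma>)"
    by (simp add: cong_rel_def sym_def network_cong.sym)
  show "trans (cong_rel \<Gamma>)"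
    unfolding cong_rel_def trans_def by (blast intro: network_cong.trans)
qed

lemma mult_network_semigroup_class:
  assumes "a \<in> gen_words \<Gamma>" "b \<in> gen_words \<Gamma>"
  shows "(cong_rel \<Gamma> `` {a}) \<otimes>\<^bsub>network_semigroup \<Gamma>\<^esub> (cong_rel \<Gamma> `` {b}) = cong_rel \<Gamma> `` {a @ b}"
proof -
  have "cong_rel \<Gamma> `` {a' @ b'} = cong_rel \<Gamma> `` {a @ b}"
    if "a' \<in> cong_rel \<Gamma> `` {a}" "b' \<in> cong_rel \<Gamma> `` {b}" for a' b'
  proof (rule equiv_class_eq[OF equiv_cong_rel])
    show "(a' @ b', a @ b) \<in> cong_rel \<Gamma>"
      using that by (simp add: cong_rel_def network_cong.append network_cong.sym)
  qed
  moreover have "a \<in> cong_rel \<Gamma> `` {a}" "b \<in> cong_rel \<Gamma> `` {b}"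
    using assms by (simp_all add: cong_rel_def network_cong.refl)
  ultimately show ?thesis
    unfolding network_semigroup_def monoid.simps by blast
qed

lemma carrier_network_semigroup:
  "carrier (network_semigroup \<Gamma>) = (\<lambda>a. cong_rel \<Gamma> `` {a}) ` gen_words \<Gamma>"
  by (auto simp: network_semigroup_def quotient_def)

lemma network_semigroup_closed:
  "P \<in> carrier (network_semigroup \<Gamma>) \<Longrightarrow> R \<in> carrier (network_semigroup \<Gamma>) \<Longrightarrow>
   P \<otimes>\<^bsub>network_semigroup \<Gamma>\<^esub> R \<in> carrier (network_semigroup \<Gamma>)"
  by (auto simp: carrier_network_semigroup mult_network_semigroup_class gen_words_append)

lemma network_semigroup_assoc:
  "P \<in> carrier (network_semigroup \<Gamma>) \<Longrightarrow> R \<in> carrier (network_semigroup \<Gamma>) \<Longrightarrow>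
   S \<in> carrier (network_semigroup \<Gamma>) \<Longrightarrow>
   (P \<otimes>\<^bsub>network_semigroup \<Gamma>\<^esub> R) \<otimes>\<^bsub>network_semigroup \<Gamma>\<^esub> S =
   P \<otimes>\<^bsub>network_semigroup \<Gamma>\<^esub> (R \<otimes>\<^bsub>network_semigroup \<Gamma>\<^esub> S)"
  by (auto simp: carrier_network_semigroup mult_network_semigroup_class gen_words_append)

end

theory Submission
  imports Defs
begin

text \<open>An isomorphism of networks renames the generators and respects every relation, so the word map
  it induces descends to an isomorphism of semigroups. Injectivity on vertices and on relations is
  needed because (NR2), (NR3) and (NR5) speak of disjointness and of inequality.

  For the converse, the network is read off the multiplication of \<open>Q\<^sub>\<Gamma>\<close> alone.

  \<^item> The elements of \<open>T\<^sup>0\<close> are the nonzero \<open>e\<close> such that \<open>f e = e\<close> only for \<open>f = e\<close>: a nonzero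
    element with first letter \<open>x\<close> is fixed by \<open>\<^bold>s(x)\<close> on the left, so such an \<open>e\<close> can only be \<open>\<^bold>s(x)\<close>
    (\<open>left_rigid_eq\<close>).
  \<^item> \<open>A B = 0\<close> in \<open>Q\<^sub>\<Gamma>\<close> iff \<open>A\<close> and \<open>B\<close> are disjoint (\<open>obj_mult_obj_absorbing_iff\<close>). Hence singletons
    are the elements of \<open>T\<^sup>0\<close> that do not meet two disjoint elements of \<open>T\<^sup>0\<close>
    (\<open>atomic_rigid_eq\<close>), and \<open>A\<close> is recovered as the set of those \<open>v\<close> with \<open>{v} A \<noteq> 0\<close>.
  \<^item> If \<open>y x \<in> T\<^sup>0\<close> and \<open>x \<notin> T\<^sup>0\<close>, then \<open>x\<close> is a nonempty product of relations. Every \<open>t \<in> T\<close> is such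
    an \<open>x\<close>, because \<open>t\<^sup>-\<^sup>1 t = \<^bold>r(t)\<close>, and \<open>T\<close> consists of those that are not products of two of them
    (\<open>prime_paths_eq\<close>).
  \<^item> Finally \<open>\<^bold>s(t)\<close> and \<open>\<^bold>r(t)\<close> are the unique \<open>A \<in> T\<^sup>0\<close> with \<open>A t = t\<close> and \<open>t A = t\<close>.

  What makes these claims work is a way to show that two words are not congruent. Rather than a
  confluent rewriting system with all its normal forms, this uses one left action of \<open>Q\<^sub>\<Gamma>\<close> on a
  small set of states (\<open>act_network_cong\<close>): enough of the left regular action to see which words
  multiplied by some \<open>A \<in> T\<^sup>0\<close> yield a path. If a word \<open>w\<close> moves the state \<open>A\<close> to the path \<open>p\<close>, then
  \<open>w A\<close> and \<open>p A\<close> are congruent, and the last letter of \<open>w\<close> has range \<open>A\<close>, so that \<open>A\<close> may be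
  dropped after \<open>w\<close>. This turns knowledge about the action into congruences.\<close>

section \<open>Classes of words\<close>

abbreviation word_class :: "('v, 't) network_data \<Rightarrow> ('v, 't) symb list \<Rightarrow> ('v, 't) symb list set" where
  "word_class \<Gamma> w \<equiv> cong_rel \<Gamma> `` {w}"

lemma word_class_eq_iff:
  assumes "a \<in> gen_words \<Gamma>" "b \<in> gen_words \<Gamma>"
  shows "word_class \<Gamma> a = word_class \<Gamma> b \<longleftrightarrow> network_cong \<Gamma> a b"
  using eq_equiv_class_iff[OF equiv_cong_rel assms] by (simp add: cong_rel_def)

lemma word_class_eqI: "network_cong \<Gamma> a b \<Longrightarrow> word_class \<Gamma> a = word_class \<Gamma> b"
  using network_cong_gen_words word_class_eq_iff by blast

lemma word_class_closed: "a \<in> gen_words \<Gamma> \<Longrightarrow> word_class \<Gamma> a \<in> carrier (network_semigroup \<Gamma>)"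
  by (simp add: carrier_network_semigroup)

lemma gen_words_singleton_iff [simp]: "[x] \<in> gen_words \<Gamma> \<longleftrightarrow> x \<in> gens \<Gamma>"
  by (auto simp: gen_words_def)

lemma gens_iff [simp]:
  "Rel t \<in> gens \<Gamma> \<longleftrightarrow> t \<in> rels \<Gamma>"
  "Inv t \<in> gens \<Gamma> \<longleftrightarrow> t \<in> rels \<Gamma>"
  "Obj A \<in> gens \<Gamma> \<longleftrightarrow> A \<in> rels0 \<Gamma>"
  "Zero \<in> gens \<Gamma>"
  by (auto simp: gens_def nz_gens_def)

lemma path_gen_words: "p \<in> lists (rels \<Gamma>) \<Longrightarrow> p \<noteq> [] \<Longrightarrow> map Rel p \<in> gen_words \<Gamma>"
  by (auto simp: gen_words_def)

lemma nz_gens_iff [simp]: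
  "Rel t \<in> nz_gens \<Gamma> \<longleftrightarrow> t \<in> rels \<Gamma>"
  "Inv t \<in> nz_gens \<Gamma> \<longleftrightarrow> t \<in> rels \<Gamma>"
  "Obj A \<in> nz_gens \<Gamma> \<longleftrightarrow> A \<in> rels0 \<Gamma>"
  "Zero \<notin> nz_gens \<Gamma>"
  by (auto simp: nz_gens_def)

lemma rels0_intros [simp, intro]:
  "t \<in> rels \<Gamma> \<Longrightarrow> src \<Gamma> t \<in> rels0 \<Gamma>"
  "t \<in> rels \<Gamma> \<Longrightarrow> rng \<Gamma> t \<in> rels0 \<Gamma>"
  "v \<in> verts \<Gamma> \<Longrightarrow> {v} \<in> rels0 \<Gamma>"
  by (auto simp: rels0_def)

lemma (in network) rels0_nonempty: "A \<in> rels0 \<Gamma> \<Longrightarrow> A \<noteq> {}"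
  using src_nonempty rng_nonempty by (auto simp: rels0_def)

lemma (in network) rels0_subset: "A \<in> rels0 \<Gamma> \<Longrightarrow> A \<subseteq> verts \<Gamma>"
  using src_subset rng_subset by (fastforce simp: rels0_def)

section \<open>Isomorphic networks have isomorphic semigroups\<close>

primrec symb_map :: "('v \<Rightarrow> 'w) \<Rightarrow> ('t \<Rightarrow> 'u) \<Rightarrow> ('v, 't) symb \<Rightarrow> ('w, 'u) symb" where
  "symb_map f g (Rel t) = Rel (g t)"
| "symb_map f g (Obj A) = Obj (f ` A)"
| "symb_map f g (Inv t) = Inv (g t)"
| "symb_map f g Zero = Zero"

lemma symb_map_src_rng:
  assumes "network_hom \<Gamma> \<Delta> f g" "x \<in> nz_gens \<Gamma>"
  shows "symb_src \<Delta> (symb_map f g x) = f ` symb_src \<Gamma> x"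
    and "symb_rng \<Delta> (symb_map f g x) = f ` symb_rng \<Gamma> x"
  using assms by (cases x; simp add: network_hom_def)+

lemma rels0_image:
  assumes "network_hom \<Gamma> \<Delta> f g" "A \<in> rels0 \<Gamma>"
  shows "f ` A \<in> rels0 \<Delta>"
  using assms unfolding network_hom_def rels0_def by (fastforce simp: Pi_iff)

lemma symb_map_gens:
  assumes "network_hom \<Gamma> \<Delta> f g"
  shows "x \<in> nz_gens \<Gamma> \<Longrightarrow> symb_map f g x \<in> nz_gens \<Delta>"
    and "x \<in> gens \<Gamma> \<Longrightarrow> symb_map f g x \<in> gens \<Delta>"
  using assms rels0_image[OF assms]
  by (auto simp: network_hom_def gens_def nz_gens_def Pi_iff)

lemma gen_words_map:
  assumes "network_hom \<Gamma> \<Delta> f g" "w \<in> gen_words \<Gamma>"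
  shows "map (symb_map f g) w \<in> gen_words \<Delta>"
  using assms symb_map_gens(2)[OF assms(1)] by (auto simp: gen_words_def in_lists_conv_set)

text \<open>(NR1), (NR4) and (NR6) survive any homomorphism; (NR2) needs that \<open>f\<close> keeps disjoint sets
  disjoint, (NR3) that \<open>g\<close> and (NR5) that \<open>f\<close> keeps distinct things distinct.\<close>

lemma (in network) network_rel_map:
  assumes hom: "network_hom \<Gamma> \<Delta> f g"
    and inj: "inj_on f (verts \<Gamma>)" "inj_on g (rels \<Gamma>)"
    and "network_rel \<Gamma> a b"
  shows "network_rel \<Delta> (map (symb_map f g) a) (map (symb_map f g) b)"
  using assms(4)
proof cases
  case (NR1_left x)
  then show ?thesis
    using network_rel.NR1_left[OF symb_map_gens(1)[OF hom]] by (simp add: symb_map_src_rng[OF hom])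
next
  case (NR1_right x)
  then show ?thesis
    using network_rel.NR1_right[OF symb_map_gens(1)[OF hom]] by (simp add: symb_map_src_rng[OF hom])
next
  case (NR2 x y)
  have "symb_rng \<Gamma> x \<subseteq> verts \<Gamma>" "symb_src \<Gamma> y \<subseteq> verts \<Gamma>"
    using NR2 by (simp_all add: rels0_subset symb_src_rng_rels0)
  then have "f ` symb_rng \<Gamma> x \<inter> f ` symb_src \<Gamma> y = {}"
    using NR2(5) inj_on_image_Int[OF inj(1), symmetric] by simp
  then show ?thesis
    using NR2 by (simp add: network_rel.NR2 symb_map_gens[OF hom] symb_map_src_rng[OF hom])
next
  case (NR3 t u)
  then show ?thesis
    using hom inj(2) by (auto intro!: network_rel.NR3 simp: network_hom_def inj_on_def)
next
  case (NR4 t)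
  then show ?thesis
    using hom network_rel.NR4[of "g t" \<Delta>] by (auto simp: network_hom_def)
next
  case (NR5 t A)
  have "f ` src \<Gamma> t \<noteq> f ` A"
    using NR5 by (simp add: inj_on_image_eq_iff[OF inj(1)] rels0_subset)
  then show ?thesis
    using NR5 hom rels0_image[OF hom] by (auto intro!: network_rel.NR5 simp: network_hom_def)
next
  case (NR6_left x)
  then show ?thesis
    by (simp add: network_rel.NR6_left symb_map_gens[OF hom])
next
  case (NR6_right x)
  then show ?thesis
    by (simp add: network_rel.NR6_right symb_map_gens[OF hom])
qed

lemma (in network) network_cong_map:
  assumes "network_hom \<Gamma> \<Delta> f g" "inj_on f (verts \<Gamma>)" "inj_on g (rels \<Gamma>)"
    and "network_cong \<Gamma> a b"
  shows "network_cong \<Delta> (map (symb_map f g) a) (map (symb_map f g) b)"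
  using assms(4)
proof induction
  case (base a b)
  then show ?case
    using network_rel_map[OF assms(1-3)] network_cong.base by blast
next
  case (refl a)
  then show ?case
    using gen_words_map[OF assms(1)] network_cong.refl by blast
next
  case (append a b c d)
  then show ?case
    by (simp add: network_cong.append)
qed (blast intro: network_cong.sym network_cong.trans)+

lemma network_hom_inv:
  assumes hom: "network_hom \<Gamma> \<Delta> f g" and net: "network \<Gamma>"
    and bij: "bij_betw f (verts \<Gamma>) (verts \<Delta>)" "bij_betw g (rels \<Gamma>) (rels \<Delta>)"
  shows "network_hom \<Delta> \<Gamma> (inv_into (verts \<Gamma>) f) (inv_into (rels \<Gamma>) g)"
proof -
  let ?f' = "inv_into (verts \<Gamma>) f" and ?g' = "inv_into (rels \<Gamma>) g"
  have maps: "?f' \<in> verts \<Delta> \<rightarrow> verts \<Gamma>" "?g' \<in> rels \<Delta> \<rightarrow> rels \<Gamma>"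
    using bij by (auto simp: bij_betw_def inv_into_into)
  have "?f' ` src \<Delta> u = src \<Gamma> (?g' u) \<and> ?f' ` rng \<Delta> u = rng \<Gamma> (?g' u)" if u: "u \<in> rels \<Delta>" for u
  proof -
    have t: "?g' u \<in> rels \<Gamma>" "g (?g' u) = u"
      using u maps bij by (auto simp: bij_betw_inv_into_right)
    have "?f' ` f ` src \<Gamma> (?g' u) = src \<Gamma> (?g' u)" "?f' ` f ` rng \<Gamma> (?g' u) = rng \<Gamma> (?g' u)"
      using bij(1) t(1) network.src_subset[OF net] network.rng_subset[OF net]
      by (auto simp: bij_betw_def intro!: inv_into_image_cancel)
    then show ?thesis
      using hom t by (simp add: network_hom_def)
  qed
  then show ?thesis
    using maps by (simp add: network_hom_def)
qed

lemma map_symb_map_inverse: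
  assumes "\<And>v. v \<in> verts \<Gamma> \<Longrightarrow> f' (f v) = v" "\<And>t. t \<in> rels \<Gamma> \<Longrightarrow> g' (g t) = t"
    and net: "network \<Gamma>" and w: "w \<in> gen_words \<Gamma>"
  shows "map (symb_map f' g') (map (symb_map f g) w) = w"
proof -
  have "f' ` f ` A = A" if "A \<in> rels0 \<Gamma>" for A
    using assms(1) network.rels0_subset[OF net that] by force
  then have "symb_map f' g' (symb_map f g x) = x" if "x \<in> gens \<Gamma>" for x
    using that assms(2) by (cases x) simp_all
  then show ?thesis
    using w by (auto simp: gen_words_def in_lists_conv_set intro!: map_idI)
qed

lemma network_semigroup_iso:
  assumes net: "network \<Gamma>" "network \<Delta>" and iso: "network_isomorphic \<Gamma> \<Delta>"
  shows "network_semigroup \<Gamma> \<cong> network_semigroup \<Delta>"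
proof -
  obtain f g where hom: "network_hom \<Gamma> \<Delta> f g"
    and bij: "bij_betw f (verts \<Gamma>) (verts \<Delta>)" "bij_betw g (rels \<Gamma>) (rels \<Delta>)"
    using iso by (auto simp: network_isomorphic_def)
  define f' g' where "f' = inv_into (verts \<Gamma>) f" and "g' = inv_into (rels \<Gamma>) g"
  define \<sigma> \<tau> where "\<sigma> = map (symb_map f g)" and "\<tau> = map (symb_map f' g')"
  have hom': "network_hom \<Delta> \<Gamma> f' g'"
    using network_hom_inv[OF hom net(1) bij] by (simp add: f'_def g'_def)
  have bij': "bij_betw f' (verts \<Delta>) (verts \<Gamma>)" "bij_betw g' (rels \<Delta>) (rels \<Gamma>)"
    using bij by (simp_all add: f'_def g'_def bij_betw_inv_into)
  have \<sigma>_words: "\<sigma> a \<in> gen_words \<Delta>" if "a \<in> gen_words \<Gamma>" for a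
    using gen_words_map[OF hom that] by (simp add: \<sigma>_def)
  have \<tau>_words: "\<tau> b \<in> gen_words \<Gamma>" if "b \<in> gen_words \<Delta>" for b
    using gen_words_map[OF hom' that] by (simp add: \<tau>_def)
  have \<sigma>_cong: "network_cong \<Delta> (\<sigma> a) (\<sigma> b)" if "network_cong \<Gamma> a b" for a b
    using network.network_cong_map[OF net(1) hom _ _ that] bij by (simp add: \<sigma>_def bij_betw_def)
  have \<tau>_cong: "network_cong \<Gamma> (\<tau> a) (\<tau> b)" if "network_cong \<Delta> a b" for a b
    using network.network_cong_map[OF net(2) hom' _ _ that] bij' by (simp add: \<tau>_def bij_betw_def)
  have \<tau>\<sigma>: "\<tau> (\<sigma> a) = a" if "a \<in> gen_words \<Gamma>" for a
    unfolding \<sigma>_def \<tau>_def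
    using bij by (intro map_symb_map_inverse[OF _ _ net(1) that])
      (simp_all add: f'_def g'_def bij_betw_inv_into_left)
  have \<sigma>\<tau>: "\<sigma> (\<tau> b) = b" if "b \<in> gen_words \<Delta>" for b
    unfolding \<sigma>_def \<tau>_def
    using bij by (intro map_symb_map_inverse[OF _ _ net(2) that])
      (simp_all add: f'_def g'_def bij_betw_inv_into_right)
  \<comment> \<open>The image of a class under the word map is a full class, since \<open>\<tau>\<close> carries congruences back.\<close>
  have image_class: "\<sigma> ` word_class \<Gamma> a = word_class \<Delta> (\<sigma> a)" if "a \<in> gen_words \<Gamma>" for a
  proof (intro subset_antisym subsetI)
    fix b assume "b \<in> word_class \<Delta> (\<sigma> a)"
    then have b: "network_cong \<Delta> (\<sigma> a) b"
      by (simp add: cong_rel_def)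
    then have "network_cong \<Gamma> a (\<tau> b)" "\<sigma> (\<tau> b) = b"
      using \<tau>_cong[OF b] \<tau>\<sigma>[OF that] \<sigma>\<tau> network_cong_gen_words by auto
    then show "b \<in> \<sigma> ` word_class \<Gamma> a"
      by (force simp: cong_rel_def)
  qed (auto simp: cong_rel_def intro: \<sigma>_cong)
  have "image \<sigma> \<in> iso (network_semigroup \<Gamma>) (network_semigroup \<Delta>)"
  proof (rule isoI)
    show "image \<sigma> \<in> hom (network_semigroup \<Gamma>) (network_semigroup \<Delta>)"
    proof (rule homI)
      fix P R assume "P \<in> carrier (network_semigroup \<Gamma>)" "R \<in> carrier (network_semigroup \<Gamma>)"
      then obtain a b where "a \<in> gen_words \<Gamma>" "b \<in> gen_words \<Gamma>"
        "P = word_class \<Gamma> a" "R = word_class \<Gamma> b"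
        by (auto simp: carrier_network_semigroup)
      moreover have "\<sigma> (a @ b) = \<sigma> a @ \<sigma> b"
        by (simp add: \<sigma>_def)
      ultimately show "\<sigma> ` (P \<otimes>\<^bsub>network_semigroup \<Gamma>\<^esub> R) = \<sigma> ` P \<otimes>\<^bsub>network_semigroup \<Delta>\<^esub> \<sigma> ` R"
        by (simp add: mult_network_semigroup_class image_class gen_words_append \<sigma>_words)
    qed (auto simp: carrier_network_semigroup image_class \<sigma>_words)
    show "bij_betw (image \<sigma>) (carrier (network_semigroup \<Gamma>)) (carrier (network_semigroup \<Delta>))"
    proof (rule bij_betw_imageI)
      show "inj_on (image \<sigma>) (carrier (network_semigroup \<Gamma>))"
      proof (rule inj_onI)
        fix P R assume "P \<in> carrier (network_semigroup \<Gamma>)" "R \<in> carrier (network_semigroup \<Gamma>)"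
          and eq: "\<sigma> ` P = \<sigma> ` R"
        then obtain a b where ab: "a \<in> gen_words \<Gamma>" "b \<in> gen_words \<Gamma>"
          "P = word_class \<Gamma> a" "R = word_class \<Gamma> b"
          by (auto simp: carrier_network_semigroup)
        then have "network_cong \<Delta> (\<sigma> a) (\<sigma> b)"
          using eq by (simp add: image_class word_class_eq_iff \<sigma>_words)
        then show "P = R"
          using \<tau>_cong[of "\<sigma> a" "\<sigma> b"] ab by (simp add: \<tau>\<sigma> word_class_eqI)
      qed
      show "image \<sigma> ` carrier (network_semigroup \<Gamma>) = carrier (network_semigroup \<Delta>)"
      proof (intro subset_antisym subsetI)
        fix R assume "R \<in> carrier (network_semigroup \<Delta>)"
        then obtain b where b: "b \<in> gen_words \<Delta>" "R = word_class \<Delta> b"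
          by (auto simp: carrier_network_semigroup)
        then have "R = \<sigma> ` word_class \<Gamma> (\<tau> b)"
          by (simp add: image_class \<tau>_words \<sigma>\<tau>)
        then show "R \<in> image \<sigma> ` carrier (network_semigroup \<Gamma>)"
          using word_class_closed[OF \<tau>_words[OF b(1)]] by blast
      qed (auto simp: carrier_network_semigroup image_class \<sigma>_words)
    qed
  qed
  then show ?thesis
    unfolding is_iso_def by blast
qed

section \<open>A left action on paths\<close>

text \<open>The state \<open>Live p A B\<close> stands for the product \<open>p A B\<close> of a path \<open>p\<close> of consecutive relations, each
  ending exactly where the next one begins and the last one ending at \<open>A\<close>, with \<open>A, B \<in> T\<^sup>0\<close>. It is pure
  when \<open>A = B\<close>, and then stands for \<open>p A\<close>. The impure states serve only to keep \<open>A B\<close> apart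
  from zero when \<open>A\<close> and \<open>B\<close> are distinct but not disjoint; all more complicated products may be
  merged with zero in \<open>Dead\<close>.\<close>

datatype ('v, 't) state = Dead | Live "'t list" "'v set" "'v set"

definition path_src :: "('v, 't) network_data \<Rightarrow> 't list \<Rightarrow> 'v set \<Rightarrow> 'v set" where
  "path_src \<Gamma> p A = (case p of [] \<Rightarrow> A | t # _ \<Rightarrow> src \<Gamma> t)"

text \<open>A letter whose range is the source of a path composes with it. If it only overlaps that source, the
  result is impure, and it is kept alive only for the empty path. An inverse cancels the matching
  first relation and kills everything else; in particular \<open>t\<^sup>-\<^sup>1\<close> kills the state \<open>\<^bold>s(t)\<close> with
  empty path, where the true product would be \<open>t\<^sup>-\<^sup>1\<close> itself. Requiring the remainder of the path to
  begin at \<open>\<^bold>r(t)\<close> makes (NR1) hold for \<open>t\<^sup>-\<^sup>1\<close> on all states, even on those whose list of relations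
  is no path.\<close>

fun act_symb :: "('v, 't) network_data \<Rightarrow> ('v, 't) symb \<Rightarrow> ('v, 't) state \<Rightarrow> ('v, 't) state" where
  "act_symb \<Gamma> (Obj D) (Live p A B) =
     (if D = path_src \<Gamma> p A then Live p A B
      else if p = [] \<and> A = B \<and> D \<inter> A \<noteq> {} then Live [] D B else Dead)"
| "act_symb \<Gamma> (Rel t) (Live p A B) =
     (if rng \<Gamma> t = path_src \<Gamma> p A then Live (t # p) A B
      else if p = [] \<and> A = B \<and> rng \<Gamma> t \<inter> A \<noteq> {} then Live [t] (rng \<Gamma> t) B else Dead)"
| "act_symb \<Gamma> (Inv t) (Live p A B) =
     (if p \<noteq> [] \<and> hd p = t \<and> path_src \<Gamma> (tl p) A = rng \<Gamma> t then Live (tl p) A B else Dead)"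
| "act_symb \<Gamma> _ _ = Dead"

abbreviation act :: "('v, 't) network_data \<Rightarrow> ('v, 't) symb list \<Rightarrow> ('v, 't) state \<Rightarrow> ('v, 't) state" where
  "act \<Gamma> w m \<equiv> foldr (act_symb \<Gamma>) w m"

lemma act_Dead [simp]: "act \<Gamma> w Dead = Dead"
  by (induction w) auto

lemma path_src_simps [simp]:
  "path_src \<Gamma> [] A = A" "path_src \<Gamma> (t # p) A = src \<Gamma> t"
  by (simp_all add: path_src_def)

lemma path_src_act_symb:
  "act_symb \<Gamma> x m = Live p A B \<Longrightarrow> path_src \<Gamma> p A = symb_src \<Gamma> x"
  by (cases x; cases m) (auto split: if_splits)

text \<open>The action respects the defining relations because a living result of a letter \<open>x\<close> always
  begins at \<open>\<^bold>s(x)\<close>; a letter applied next either fits this source exactly, overlaps it, or kills.\<close>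

lemma (in network) act_network_rel:
  assumes "network_rel \<Gamma> a b"
  shows "act \<Gamma> a m = act \<Gamma> b m"
proof (cases m)
  case (Live p A B)
  show ?thesis
    using assms
  proof cases
    case (NR1_left x)
    then show ?thesis
      using path_src_act_symb[of \<Gamma> x m] by (cases "act_symb \<Gamma> x m") auto
  next
    case (NR1_right x)
    then show ?thesis
      using Live by (cases x; cases p) auto
  next
    case (NR2 x y)
    have ne: "symb_src \<Gamma> y \<noteq> {}"
      using NR2(4) rels0_nonempty symb_src_rng_rels0 by blast
    show ?thesis
    proof (cases "act_symb \<Gamma> y m")
      case (Live p A B)
      then show ?thesis
        using NR2 ne path_src_act_symb[OF Live] by (cases x; cases p) (auto simp: Int_commute)
    qed (simp add: NR2)
  next
    case (NR3 t u)
    then show ?thesis using Live by auto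
  next
    case (NR4 t)
    then show ?thesis using Live by auto
  next
    case (NR5 t A)
    then show ?thesis using Live by (cases p) auto
  qed auto
qed simp

lemma (in network) act_network_cong: "network_cong \<Gamma> a b \<Longrightarrow> act \<Gamma> a m = act \<Gamma> b m"
  by (induction arbitrary: m rule: network_cong.induct) (auto simp: act_network_rel)

text \<open>Impurity is never undone: the factors at the right end of a state stay there.\<close>

lemma act_symb_pureD:
  assumes "act_symb \<Gamma> x m = Live q B B"
  shows "\<exists>p. m = Live p B B"
  using assms by (cases x; cases m) (auto split: if_splits)

lemma act_pureD:
  assumes "act \<Gamma> w m = Live q B B"
  shows "\<exists>p. m = Live p B B"
  using assms by (induction w arbitrary: q) (auto dest: act_symb_pureD)

lemma act_Rels_pure:
  assumes "act \<Gamma> (map Rel w) (Live p A A) = Live q A A"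
  shows "q = w @ p"
  using assms
proof (induction w arbitrary: q)
  case (Cons t w)
  then obtain q' where q': "act \<Gamma> (map Rel w) (Live p A A) = Live q' A A"
    using act_symb_pureD by force
  then show ?case
    using Cons by (auto split: if_splits)
qed simp

text \<open>Applied to the state \<open>A\<close>, a letter whose range is not \<open>A\<close> yields an impure or dead state, and the
  letters before it cannot repair this.\<close>

lemma last_symb_rng:
  assumes "act \<Gamma> (w @ [x]) (Live [] A A) = Live q A A"
  shows "symb_rng \<Gamma> x = A \<and> x \<noteq> Zero"
proof -
  obtain p where "act_symb \<Gamma> x (Live [] A A) = Live p A A"
    using assms act_pureD by fastforce
  then show ?thesis
    by (cases x) (auto split: if_splits)
qed

section \<open>Congruences between words\<close>

text \<open>Congruence is closed under multiplication by words; here the two outer words may be empty.\<close>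

lemma network_cong_in_context:
  assumes "network_cong \<Gamma> a b" "u \<in> lists (gens \<Gamma>)" "v \<in> lists (gens \<Gamma>)"
  shows "network_cong \<Gamma> (u @ a @ v) (u @ b @ v)"
proof -
  have refl: "network_cong \<Gamma> w w" if "w \<in> lists (gens \<Gamma>)" "w \<noteq> []" for w
    using that by (auto simp: gen_words_def intro: network_cong.refl)
  have right: "network_cong \<Gamma> (a @ v) (b @ v)"
    using assms refl[of v] by (cases "v = []") (auto intro: network_cong.append)
  then show ?thesis
    using assms refl[of u] by (cases "u = []") (auto intro: network_cong.append)
qed

lemma network_cong_append_rng:
  assumes "w @ [x] \<in> gen_words \<Gamma>" "x \<noteq> Zero"
  shows "network_cong \<Gamma> (w @ [x, Obj (symb_rng \<Gamma> x)]) (w @ [x])"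
  using assms network_cong_in_context[OF network_cong.base[OF network_rel.NR1_right], of x \<Gamma> w "[]"]
  by (auto simp: gen_words_def gens_def)

lemma network_cong_Cons_src:
  assumes "x # w \<in> gen_words \<Gamma>" "x \<noteq> Zero"
  shows "network_cong \<Gamma> (Obj (symb_src \<Gamma> x) # x # w) (x # w)"
  using assms network_cong_in_context[OF network_cong.base[OF network_rel.NR1_left], of x \<Gamma> "[]" w]
  by (auto simp: gen_words_def gens_def)


lemma network_cong_Zero_left:
  assumes "w \<in> lists (gens \<Gamma>)"
  shows "network_cong \<Gamma> (Zero # w) [Zero]"
  using assms
proof induction
  case (Cons x w)
  have "network_cong \<Gamma> (Zero # x # w) (Zero # w)"
    using network_cong_in_context[OF network_cong.base[OF network_rel.NR6_left[OF Cons(1)]], of "[]" w] Cons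
    by simp
  then show ?case
    using Cons.IH network_cong.trans by blast
qed (simp add: network_cong.refl)

lemma network_cong_Zero_right:
  assumes "w \<in> lists (gens \<Gamma>)"
  shows "network_cong \<Gamma> (w @ [Zero]) [Zero]"
  using assms
proof induction
  case (Cons x w)
  have "network_cong \<Gamma> (x # w @ [Zero]) [x, Zero]"
    using network_cong_in_context[OF Cons.IH, of "[x]" "[]"] Cons by simp
  then show ?case
    using network_cong.base[OF network_rel.NR6_right[OF Cons(1)]] network_cong.trans by fastforce
qed (simp add: network_cong.refl)

text \<open>A single letter acts on pure states as multiplication does in \<open>Q\<^sub>\<Gamma>\<close>.\<close>

lemma act_symb_pure_word:
  assumes "x \<in> gens \<Gamma>" "p \<in> lists (rels \<Gamma>)" "A \<in> rels0 \<Gamma>"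
    and act: "act_symb \<Gamma> x (Live p A A) = Live q A A"
  shows "q \<in> lists (rels \<Gamma>) \<and>
    network_cong \<Gamma> (x # map Rel p @ [Obj A]) (map Rel q @ [Obj A])"
proof -
  have words: "map Rel r @ [Obj A] \<in> gen_words \<Gamma>" if "r \<in> lists (rels \<Gamma>)" for r
    using that assms(3) by (auto simp: gen_words_def)
  \<comment> \<open>By (NR1), the source of a path is absorbed by its first letter.\<close>
  have absorb: "network_cong \<Gamma> (Obj (path_src \<Gamma> r A) # map Rel r @ [Obj A]) (map Rel r @ [Obj A])"
    if "r \<in> lists (rels \<Gamma>)" for r
    using network_cong_Cons_src[of "Obj A" "[]" \<Gamma>] network_cong_Cons_src[of "Rel (hd r)" "map Rel (tl r) @ [Obj A]" \<Gamma>]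
      words[OF that] by (cases r) auto
  show ?thesis
  proof (cases x)
    case (Rel t)
    then have "q = t # p"
      using act by (auto split: if_splits)
    then show ?thesis
      using Rel assms words[of q] by (auto intro: network_cong.refl)
  next
    case (Obj D)
    then have "D = path_src \<Gamma> p A" "q = p"
      using act by (auto split: if_splits)
    then show ?thesis
      using Obj assms absorb[of p] by simp
  next
    case (Inv t)
    then have p: "p = t # q" "path_src \<Gamma> q A = rng \<Gamma> t"
      using act by (auto split: if_splits)
    then have q: "q \<in> lists (rels \<Gamma>)" "t \<in> rels \<Gamma>"
      using assms by auto
    have "network_cong \<Gamma> (Inv t # Rel t # map Rel q @ [Obj A]) (Obj (rng \<Gamma> t) # map Rel q @ [Obj A])"
      using network_cong_in_context[OF network_cong.base[OF network_rel.NR4[OF q(2)]], of "[]" "map Rel q @ [Obj A]"]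
        words[OF q(1)] by (simp add: gen_words_def)
    then show ?thesis
      using absorb[OF q(1)] p Inv q network_cong.trans by auto
  next
    case Zero
    then show ?thesis
      using act by simp
  qed
qed

text \<open>The action is faithful on pure results: it computes the product \<open>w A\<close>.\<close>

lemma act_pure_word:
  assumes "w \<in> lists (gens \<Gamma>)" "A \<in> rels0 \<Gamma>"
    and "act \<Gamma> w (Live [] A A) = Live p A A"
  shows "p \<in> lists (rels \<Gamma>) \<and> network_cong \<Gamma> (w @ [Obj A]) (map Rel p @ [Obj A])"
  using assms(1,3)
proof (induction w arbitrary: p)
  case Nil
  then show ?case
    using assms(2) by (simp add: network_cong.refl)
next
  case (Cons x w)
  then obtain q where q: "act \<Gamma> w (Live [] A A) = Live q A A"
    using act_symb_pureD by force
  then have IH: "q \<in> lists (rels \<Gamma>)" "network_cong \<Gamma> (w @ [Obj A]) (map Rel q @ [Obj A])"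
    using Cons by auto
  then have "network_cong \<Gamma> (x # w @ [Obj A]) (x # map Rel q @ [Obj A])"
    using network_cong_in_context[OF IH(2), of "[x]" "[]"] Cons by simp
  moreover have "p \<in> lists (rels \<Gamma>) \<and>
      network_cong \<Gamma> (x # map Rel q @ [Obj A]) (map Rel p @ [Obj A])"
    using act_symb_pure_word[of x \<Gamma> q A p] Cons IH q assms(2) by simp
  ultimately show ?case
    using network_cong.trans by auto
qed

lemma gen_words_snocE:
  assumes "w \<in> gen_words \<Gamma>"
  obtains w' x where "w = w' @ [x]"
  using assms by (cases w rule: rev_cases) (auto simp: gen_words_def)

lemma network_cong_append_Obj:
  assumes "w \<in> gen_words \<Gamma>" "act \<Gamma> w (Live [] A A) = Live p A A"
  shows "network_cong \<Gamma> (w @ [Obj A]) w"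
proof -
  obtain w' x where w: "w = w' @ [x]"
    using assms(1) gen_words_snocE by blast
  then show ?thesis
    using network_cong_append_rng[of w' x \<Gamma>] last_symb_rng[of \<Gamma> w' x A p] assms by simp
qed

text \<open>If \<open>v w = A\<close>, then \<open>v w\<close> fixes the pure state \<open>A\<close>, so \<open>w\<close> sends it to a pure state \<open>p A\<close>. The last
  letters of \<open>w\<close> and of \<open>p\<close> both have range \<open>A\<close>, hence \<open>w = w A = p A = p\<close> in \<open>Q\<^sub>\<Gamma>\<close>.\<close>

lemma (in network) left_invertible_word:
  assumes "v \<in> gen_words \<Gamma>" "w \<in> gen_words \<Gamma>" "A \<in> rels0 \<Gamma>"
    and cong: "network_cong \<Gamma> (v @ w) [Obj A]"
  obtains "network_cong \<Gamma> w [Obj A]"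
  | p where "p \<in> lists (rels \<Gamma>)" "p \<noteq> []" "network_cong \<Gamma> w (map Rel p)"
proof -
  have "act \<Gamma> v (act \<Gamma> w (Live [] A A)) = Live [] A A"
    using act_network_cong[OF cong] by simp
  then obtain p where p: "act \<Gamma> w (Live [] A A) = Live p A A"
    using act_pureD by blast
  have path: "p \<in> lists (rels \<Gamma>)" "network_cong \<Gamma> (w @ [Obj A]) (map Rel p @ [Obj A])"
    using act_pure_word[OF _ assms(3) p] assms(2) by (auto simp: gen_words_def)
  have w: "network_cong \<Gamma> w (map Rel p @ [Obj A])"
    using network_cong_append_Obj[OF assms(2) p] path(2) network_cong.sym network_cong.trans by blast
  show thesis
  proof (cases "p = []")
    case True
    then show thesis
      using w that(1) by simp
  next
    case False
    have "map Rel p \<in> gen_words \<Gamma>"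
      using path(1) False by (rule path_gen_words)
    moreover have "act \<Gamma> (map Rel p) (Live [] A A) = Live p A A"
      using act_network_cong[OF path(2), of "Live [] A A"] p by simp
    ultimately have "network_cong \<Gamma> (map Rel p @ [Obj A]) (map Rel p)"
      by (rule network_cong_append_Obj)
    then show thesis
      using w that(2) path(1) False network_cong.trans by blast
  qed
qed

section \<open>Isomorphism invariants of a semigroup with zero\<close>

definition absorbing :: "('a, 'b) monoid_scheme \<Rightarrow> 'a \<Rightarrow> bool" where
  "absorbing G z \<longleftrightarrow> z \<in> carrier G \<and> (\<forall>x\<in>carrier G. x \<otimes>\<^bsub>G\<^esub> z = z \<and> z \<otimes>\<^bsub>G\<^esub> x = z)"

text \<open>Characterises the elements of \<open>T\<^sup>0\<close> in \<open>Q\<^sub>\<Gamma>\<close>.\<close>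

definition left_rigid :: "('a, 'b) monoid_scheme \<Rightarrow> 'a set" where
  "left_rigid G = {e \<in> carrier G. \<not> absorbing G e \<and> (\<forall>f\<in>carrier G. f \<otimes>\<^bsub>G\<^esub> e = e \<longrightarrow> f = e)}"

text \<open>Characterises the vertices. For sets, orthogonality of \<open>b\<close> and \<open>c\<close> means disjointness, and a
  nonempty set is a singleton iff it does not meet two disjoint members of a family that contains
  all singletons.\<close>

definition atomic_rigid :: "('a, 'b) monoid_scheme \<Rightarrow> 'a set" where
  "atomic_rigid G = {e \<in> left_rigid G. \<forall>b\<in>left_rigid G. \<forall>c\<in>left_rigid G.
     absorbing G (b \<otimes>\<^bsub>G\<^esub> c) \<longrightarrow> absorbing G (e \<otimes>\<^bsub>G\<^esub> b) \<or> absorbing G (e \<otimes>\<^bsub>G\<^esub> c)}"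

text \<open>Left invertibility modulo \<open>left_rigid\<close> selects the nonempty paths, with \<open>t\<^sub>n\<^sup>-\<^sup>1 \<dots> t\<^sub>1\<^sup>-\<^sup>1\<close> as left inverse
  of \<open>t\<^sub>1 \<dots> t\<^sub>n\<close>.\<close>

definition proper_paths :: "('a, 'b) monoid_scheme \<Rightarrow> 'a set" where
  "proper_paths G = {x \<in> carrier G. \<exists>y\<in>carrier G. y \<otimes>\<^bsub>G\<^esub> x \<in> left_rigid G} - left_rigid G"

text \<open>Characterises the relations, as the paths of length one.\<close>

definition prime_paths :: "('a, 'b) monoid_scheme \<Rightarrow> 'a set" where
  "prime_paths G = {x \<in> proper_paths G. \<forall>y\<in>proper_paths G. \<forall>z\<in>proper_paths G. x \<noteq> y \<otimes>\<^bsub>G\<^esub> z}"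

context
  fixes G (structure) and H (structure) and h
  assumes h: "h \<in> iso G H"
    and closed: "\<And>x y. x \<in> carrier G \<Longrightarrow> y \<in> carrier G \<Longrightarrow> x \<otimes> y \<in> carrier G"
begin

lemma iso_surj: "carrier H = h ` carrier G"
  using h by (auto simp: iso_def bij_betw_def)

lemma iso_eq_iff: "x \<in> carrier G \<Longrightarrow> y \<in> carrier G \<Longrightarrow> h x = h y \<longleftrightarrow> x = y"
  using h by (auto simp: iso_def bij_betw_def inj_on_def)

lemma iso_mult: "x \<in> carrier G \<Longrightarrow> y \<in> carrier G \<Longrightarrow> h x \<otimes>\<^bsub>H\<^esub> h y = h (x \<otimes> y)"
  using h by (auto simp: iso_def hom_def)

lemma iso_absorbing: "x \<in> carrier G \<Longrightarrow> absorbing H (h x) \<longleftrightarrow> absorbing G x"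
  by (auto simp: absorbing_def iso_surj iso_mult iso_eq_iff closed)

lemma iso_left_rigid: "left_rigid H = h ` left_rigid G"
  by (auto simp: left_rigid_def iso_surj iso_mult iso_eq_iff closed iso_absorbing)

lemma iso_mem_left_rigid: "x \<in> carrier G \<Longrightarrow> h x \<in> left_rigid H \<longleftrightarrow> x \<in> left_rigid G"
proof -
  assume "x \<in> carrier G"
  moreover have "inj_on h (carrier G)" "left_rigid G \<subseteq> carrier G"
    using h by (auto simp: iso_def bij_betw_def left_rigid_def)
  ultimately show ?thesis
    unfolding iso_left_rigid by (simp add: inj_on_image_mem_iff)
qed

lemma iso_atomic_rigid: "atomic_rigid H = h ` atomic_rigid G"
proof -
  have "left_rigid G \<subseteq> carrier G"
    by (auto simp: left_rigid_def)
  then show ?thesis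
    unfolding atomic_rigid_def iso_left_rigid
    by (auto simp: iso_mult iso_absorbing closed subset_iff) blast+
qed

lemma iso_proper_paths: "proper_paths H = h ` proper_paths G"
proof -
  have "proper_paths H = h ` {x \<in> carrier G. h x \<in> proper_paths H}"
    by (auto simp: proper_paths_def iso_surj)
  also have "{x \<in> carrier G. h x \<in> proper_paths H} = proper_paths G"
  proof -
    have "h x \<in> proper_paths H \<longleftrightarrow> x \<in> proper_paths G" if "x \<in> carrier G" for x
      using that by (simp add: proper_paths_def iso_surj iso_mult closed iso_mem_left_rigid)
    moreover have "proper_paths G \<subseteq> carrier G"
      by (auto simp: proper_paths_def)
    ultimately show ?thesis
      by blast
  qed
  finally show ?thesis .
qed

lemma iso_prime_paths: "prime_paths H = h ` prime_paths G"
proof -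
  have "proper_paths G \<subseteq> carrier G"
    by (auto simp: proper_paths_def)
  then show ?thesis
    unfolding prime_paths_def iso_proper_paths
    by (auto simp: iso_mult iso_eq_iff closed subset_iff)
qed

end

section \<open>Reading the network off its semigroup\<close>

context network
begin

abbreviation "Q \<equiv> network_semigroup \<Gamma>"
abbreviation "obj A \<equiv> word_class \<Gamma> [Obj A]"
abbreviation "arr t \<equiv> word_class \<Gamma> [Rel t]"

lemma absorbing_iff: "absorbing Q z \<longleftrightarrow> z = word_class \<Gamma> [Zero]"
proof -
  have "absorbing Q (word_class \<Gamma> [Zero])"
    unfolding absorbing_def carrier_network_semigroup
    by (auto simp: mult_network_semigroup_class gen_words_def
        intro!: word_class_eqI network_cong_Zero_left network_cong_Zero_right)
  then show ?thesis
    unfolding absorbing_def by metis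
qed

lemma obj_not_absorbing: "A \<in> rels0 \<Gamma> \<Longrightarrow> \<not> absorbing Q (obj A)"
  using act_network_cong[of "[Obj A]" "[Zero]" "Live [] A A"]
  by (auto simp: absorbing_iff word_class_eq_iff)

lemma obj_mult_obj_absorbing_iff:
  assumes "A \<in> rels0 \<Gamma>" "B \<in> rels0 \<Gamma>"
  shows "absorbing Q (obj A \<otimes>\<^bsub>Q\<^esub> obj B) \<longleftrightarrow> A \<inter> B = {}"
proof
  assume "absorbing Q (obj A \<otimes>\<^bsub>Q\<^esub> obj B)"
  then have "network_cong \<Gamma> [Obj A, Obj B] [Zero]"
    using assms word_class_eq_iff[of "[Obj A, Obj B]" \<Gamma> "[Zero]"]
    by (simp add: absorbing_iff mult_network_semigroup_class gen_words_def)
  then show "A \<inter> B = {}"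
    using act_network_cong[of _ _ "Live [] B B"] by (fastforce split: if_splits)
next
  assume "A \<inter> B = {}"
  then show "absorbing Q (obj A \<otimes>\<^bsub>Q\<^esub> obj B)"
    using assms network_cong.base[OF network_rel.NR2[of "Obj A" \<Gamma> "Obj B"]]
    by (simp add: absorbing_iff mult_network_semigroup_class word_class_eqI)
qed

lemma obj_inj: "inj_on obj (rels0 \<Gamma>)"
proof (rule inj_onI)
  fix A B assume "A \<in> rels0 \<Gamma>" "B \<in> rels0 \<Gamma>" "obj A = obj B"
  then have "network_cong \<Gamma> [Obj A] [Obj B]"
    by (simp add: word_class_eq_iff)
  then show "A = B"
    using act_network_cong[of _ _ "Live [] B B"] by (fastforce split: if_splits)
qed

lemma arr_inj: "inj_on arr (rels \<Gamma>)"
proof (rule inj_onI)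
  fix t u assume "t \<in> rels \<Gamma>" "u \<in> rels \<Gamma>" "arr t = arr u"
  then have "network_cong \<Gamma> [Rel t] [Rel u]"
    by (simp add: word_class_eq_iff)
  then show "t = u"
    using act_network_cong[of _ _ "Live [] (rng \<Gamma> t) (rng \<Gamma> t)"] by (fastforce split: if_splits)
qed

lemma obj_mult_arr_iff:
  assumes "A \<in> rels0 \<Gamma>" "t \<in> rels \<Gamma>"
  shows "obj A \<otimes>\<^bsub>Q\<^esub> arr t = arr t \<longleftrightarrow> A = src \<Gamma> t"
proof
  assume "obj A \<otimes>\<^bsub>Q\<^esub> arr t = arr t"
  then have "network_cong \<Gamma> [Obj A, Rel t] [Rel t]"
    using assms by (simp add: mult_network_semigroup_class word_class_eq_iff gen_words_def)
  then show "A = src \<Gamma> t"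
    using act_network_cong[of _ _ "Live [] (rng \<Gamma> t) (rng \<Gamma> t)"] by (fastforce split: if_splits)
next
  assume "A = src \<Gamma> t"
  then show "obj A \<otimes>\<^bsub>Q\<^esub> arr t = arr t"
    using assms network_cong.base[OF network_rel.NR1_left[of "Rel t" \<Gamma>]]
    by (simp add: mult_network_semigroup_class word_class_eqI)
qed

lemma arr_mult_obj_iff:
  assumes "A \<in> rels0 \<Gamma>" "t \<in> rels \<Gamma>"
  shows "arr t \<otimes>\<^bsub>Q\<^esub> obj A = arr t \<longleftrightarrow> A = rng \<Gamma> t"
proof
  assume "arr t \<otimes>\<^bsub>Q\<^esub> obj A = arr t"
  then have "network_cong \<Gamma> [Rel t, Obj A] [Rel t]"
    using assms by (simp add: mult_network_semigroup_class word_class_eq_iff gen_words_def)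
  then show "A = rng \<Gamma> t"
    using act_network_cong[of _ _ "Live [] (rng \<Gamma> t) (rng \<Gamma> t)"] by (fastforce split: if_splits)
next
  assume "A = rng \<Gamma> t"
  then show "arr t \<otimes>\<^bsub>Q\<^esub> obj A = arr t"
    using assms network_cong.base[OF network_rel.NR1_right[of "Rel t" \<Gamma>]]
    by (simp add: mult_network_semigroup_class word_class_eqI)
qed

text \<open>An \<open>e\<close> in \<open>left_rigid\<close> equals \<open>\<^bold>s(x)\<close> for its first letter \<open>x\<close>. Conversely, if \<open>f A = A\<close> then a word for
  \<open>f\<close> fixes the pure state \<open>A\<close>, which forces the range of its last letter to be \<open>A\<close>, so that
  \<open>f = f A = A\<close>.\<close>

lemma left_rigid_eq: "left_rigid Q = obj ` rels0 \<Gamma>"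
proof (intro subset_antisym subsetI)
  fix e assume e: "e \<in> left_rigid Q"
  then obtain w where w: "w \<in> gen_words \<Gamma>" "e = word_class \<Gamma> w"
    by (auto simp: left_rigid_def carrier_network_semigroup)
  then obtain x w' where x: "w = x # w'"
    by (cases w) (auto simp: gen_words_def)
  then have gens: "x \<in> gens \<Gamma>" "w' \<in> lists (gens \<Gamma>)"
    using w by (auto simp: gen_words_def)
  \<comment> \<open>A word that begins with \<open>Zero\<close> represents the absorbing element.\<close>
  have "x \<noteq> Zero"
    using e w x word_class_eqI[OF network_cong_Zero_left[OF gens(2)]]
    by (auto simp only: left_rigid_def absorbing_iff)
  then have src: "symb_src \<Gamma> x \<in> rels0 \<Gamma>"
    using gens by (auto simp: gens_def intro: symb_src_rng_rels0)
  have "obj (symb_src \<Gamma> x) \<otimes>\<^bsub>Q\<^esub> e = e"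
    using \<open>x \<noteq> Zero\<close> w x src
    by (simp add: mult_network_semigroup_class word_class_eqI network_cong_Cons_src)
  then have "obj (symb_src \<Gamma> x) = e"
    using e src word_class_closed[of "[Obj (symb_src \<Gamma> x)]" \<Gamma>] by (auto simp: left_rigid_def)
  then show "e \<in> obj ` rels0 \<Gamma>"
    using src by blast
next
  fix e assume "e \<in> obj ` rels0 \<Gamma>"
  then obtain A where A: "A \<in> rels0 \<Gamma>" "e = obj A"
    by blast
  have "f = e" if "f \<in> carrier Q" "f \<otimes>\<^bsub>Q\<^esub> e = e" for f
  proof -
    obtain w where w: "w \<in> gen_words \<Gamma>" "f = word_class \<Gamma> w"
      using \<open>f \<in> carrier Q\<close> by (auto simp: carrier_network_semigroup)
    then have cong: "network_cong \<Gamma> (w @ [Obj A]) [Obj A]"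
      using that A by (simp add: mult_network_semigroup_class word_class_eq_iff gen_words_append)
    then have "act \<Gamma> w (Live [] A A) = Live [] A A"
      using act_network_cong[OF cong, of "Live [] A A"] by simp
    then have "network_cong \<Gamma> (w @ [Obj A]) w"
      by (rule network_cong_append_Obj[OF w(1)])
    then show "f = e"
      using cong w A network_cong.sym network_cong.trans word_class_eqI by metis
  qed
  then show "e \<in> left_rigid Q"
    using A obj_not_absorbing by (simp add: left_rigid_def word_class_closed)
qed

lemma atomic_rigid_eq: "atomic_rigid Q = (\<lambda>v. obj {v}) ` verts \<Gamma>"
proof (intro subset_antisym subsetI)
  fix e assume e: "e \<in> atomic_rigid Q"
  then obtain A where A: "A \<in> rels0 \<Gamma>" "e = obj A"
    by (auto simp: atomic_rigid_def left_rigid_eq)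
  then obtain v where v: "v \<in> A" "v \<in> verts \<Gamma>"
    using rels0_nonempty rels0_subset by blast
  have "w = v" if "w \<in> A" for w
  proof (rule ccontr)
    assume "w \<noteq> v"
    have w: "w \<in> verts \<Gamma>"
      using that A rels0_subset by blast
    have "absorbing Q (obj {v} \<otimes>\<^bsub>Q\<^esub> obj {w})"
      using \<open>w \<noteq> v\<close> v w by (simp add: obj_mult_obj_absorbing_iff)
    then have "absorbing Q (e \<otimes>\<^bsub>Q\<^esub> obj {v}) \<or> absorbing Q (e \<otimes>\<^bsub>Q\<^esub> obj {w})"
      using e v w by (auto simp: atomic_rigid_def left_rigid_eq)
    then show False
      using A v w that by (simp add: obj_mult_obj_absorbing_iff)
  qed
  then have "A = {v}"
    using v by blast
  then show "e \<in> (\<lambda>v. obj {v}) ` verts \<Gamma>"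
    using A v by blast
qed (auto simp: atomic_rigid_def left_rigid_eq obj_mult_obj_absorbing_iff)

text \<open>A nonempty product of relations lengthens or spoils every state, whereas \<open>A \<in> T\<^sup>0\<close> fixes the state
  \<open>A\<close>.\<close>

lemma path_not_left_rigid:
  assumes "p \<in> lists (rels \<Gamma>)" "p \<noteq> []"
  shows "word_class \<Gamma> (map Rel p) \<notin> left_rigid Q"
proof
  assume "word_class \<Gamma> (map Rel p) \<in> left_rigid Q"
  then obtain A where "A \<in> rels0 \<Gamma>" "word_class \<Gamma> (map Rel p) = obj A"
    by (auto simp: left_rigid_eq)
  then have "network_cong \<Gamma> (map Rel p) [Obj A]"
    using word_class_eq_iff[of "map Rel p" \<Gamma> "[Obj A]"] path_gen_words[OF assms] by simp
  then have "act \<Gamma> (map Rel p) (Live [] A A) = Live [] A A"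
    using act_network_cong[of "map Rel p" "[Obj A]" "Live [] A A"] by simp
  then show False
    using act_Rels_pure[of \<Gamma> p "[]" A "[]"] assms(2) by simp
qed

lemma proper_path_word:
  assumes "x \<in> proper_paths Q"
  obtains p where "p \<in> lists (rels \<Gamma>)" "p \<noteq> []" "x = word_class \<Gamma> (map Rel p)"
proof -
  obtain v w A where vw: "v \<in> gen_words \<Gamma>" "w \<in> gen_words \<Gamma>" "x = word_class \<Gamma> w"
    and A: "A \<in> rels0 \<Gamma>" "word_class \<Gamma> v \<otimes>\<^bsub>Q\<^esub> word_class \<Gamma> w = obj A" "x \<notin> left_rigid Q"
    using assms by (auto simp: proper_paths_def carrier_network_semigroup left_rigid_eq)
  then have "network_cong \<Gamma> (v @ w) [Obj A]"
    by (simp add: mult_network_semigroup_class word_class_eq_iff gen_words_append)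
  from left_invertible_word[OF vw(1,2) A(1) this] show thesis
  proof cases
    case 1
    then show thesis
      using vw A by (simp add: left_rigid_eq word_class_eqI)
  next
    case (2 p)
    then show thesis
      using that vw by (simp add: word_class_eqI)
  qed
qed

lemma arr_proper_path:
  assumes "t \<in> rels \<Gamma>"
  shows "arr t \<in> proper_paths Q"
proof -
  have "word_class \<Gamma> [Inv t] \<otimes>\<^bsub>Q\<^esub> arr t = obj (rng \<Gamma> t)"
    using assms network_cong.base[OF network_rel.NR4[OF assms]]
    by (simp add: mult_network_semigroup_class word_class_eqI)
  then have "\<exists>y\<in>carrier Q. y \<otimes>\<^bsub>Q\<^esub> arr t \<in> left_rigid Q"
    using assms word_class_closed[of "[Inv t]" \<Gamma>] by (auto simp: left_rigid_eq)
  then show ?thesis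
    using assms path_not_left_rigid[of "[t]"] by (simp add: proper_paths_def word_class_closed)
qed

text \<open>If \<open>t q\<close> is left invertible by \<open>y\<close>, then \<open>q\<close> is left invertible by \<open>y t\<close>; so a left invertible product
  of at least two relations splits into two proper paths. In the other direction, products of
  relations that agree and are not killed have equal length, as the action on the state
  \<open>\<^bold>r(t)\<close> shows, so \<open>t\<close> does not split.\<close>

lemma prime_paths_eq: "prime_paths Q = arr ` rels \<Gamma>"
proof (intro subset_antisym subsetI)
  fix x assume x: "x \<in> prime_paths Q"
  then have proper: "x \<in> proper_paths Q"
    by (simp add: prime_paths_def)
  then obtain p where p: "p \<in> lists (rels \<Gamma>)" "p \<noteq> []" "x = word_class \<Gamma> (map Rel p)"
    using proper_path_word by blast
  then obtain t q where tq: "p = t # q" "t \<in> rels \<Gamma>" "q \<in> lists (rels \<Gamma>)"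
    by (cases p) auto
  have "q = []"
  proof (rule ccontr)
    assume "q \<noteq> []"
    then have q: "map Rel q \<in> gen_words \<Gamma>"
      using path_gen_words[OF tq(3)] by simp
    have prod: "x = arr t \<otimes>\<^bsub>Q\<^esub> word_class \<Gamma> (map Rel q)"
      using p tq q by (simp add: mult_network_semigroup_class)
    obtain y where y: "y \<in> carrier Q" "y \<otimes>\<^bsub>Q\<^esub> x \<in> left_rigid Q"
      using proper by (auto simp: proper_paths_def)
    have closed: "arr t \<in> carrier Q" "word_class \<Gamma> (map Rel q) \<in> carrier Q"
      using tq q by (simp_all add: word_class_closed)
    have "(y \<otimes>\<^bsub>Q\<^esub> arr t) \<otimes>\<^bsub>Q\<^esub> word_class \<Gamma> (map Rel q) \<in> left_rigid Q"
      using y(2) network_semigroup_assoc[OF y(1) closed] by (simp only: prod)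
    moreover have "y \<otimes>\<^bsub>Q\<^esub> arr t \<in> carrier Q"
      using y(1) closed(1) by (rule network_semigroup_closed)
    ultimately have "word_class \<Gamma> (map Rel q) \<in> proper_paths Q"
      using closed(2) path_not_left_rigid[OF tq(3) \<open>q \<noteq> []\<close>]
      by (auto simp only: proper_paths_def)
    then show False
      using x prod arr_proper_path[OF tq(2)] by (auto simp: prime_paths_def)
  qed
  then show "x \<in> arr ` rels \<Gamma>"
    using p tq by auto
next
  fix x assume "x \<in> arr ` rels \<Gamma>"
  then obtain t where t: "t \<in> rels \<Gamma>" "x = arr t"
    by blast
  have "arr t \<noteq> y \<otimes>\<^bsub>Q\<^esub> z" if y: "y \<in> proper_paths Q" and z: "z \<in> proper_paths Q" for y z
  proof
    assume eq: "arr t = y \<otimes>\<^bsub>Q\<^esub> z"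
    obtain p where p: "p \<in> lists (rels \<Gamma>)" "p \<noteq> []" "y = word_class \<Gamma> (map Rel p)"
      using y by (rule proper_path_word)
    obtain q where q: "q \<in> lists (rels \<Gamma>)" "q \<noteq> []" "z = word_class \<Gamma> (map Rel q)"
      using z by (rule proper_path_word)
    note pq = p q
    have words: "map Rel p \<in> gen_words \<Gamma>" "map Rel q \<in> gen_words \<Gamma>"
      using path_gen_words[OF p(1,2)] path_gen_words[OF q(1,2)] by simp_all
    have "network_cong \<Gamma> [Rel t] (map Rel (p @ q))"
      using eq pq t words word_class_eq_iff[of "[Rel t]" \<Gamma> "map Rel p @ map Rel q"]
      by (simp add: mult_network_semigroup_class gen_words_append)
    then have "act \<Gamma> (map Rel (p @ q)) (Live [] (rng \<Gamma> t) (rng \<Gamma> t)) = Live [t] (rng \<Gamma> t) (rng \<Gamma> t)"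
      using act_network_cong[of "[Rel t]" "map Rel (p @ q)" "Live [] (rng \<Gamma> t) (rng \<Gamma> t)"] by simp
    then have "[t] = p @ q"
      using act_Rels_pure[of \<Gamma> "p @ q" "[]" "rng \<Gamma> t" "[t]"] by simp
    then show False
      using pq by (simp add: Cons_eq_append_conv)
  qed
  then show "x \<in> prime_paths Q"
    using t arr_proper_path by (simp add: prime_paths_def)
qed

end

lemma bij_betw_transport:
  assumes "inj_on h (i ` X)" "inj_on i X" "inj_on j Y" "h ` i ` X = j ` Y"
  obtains k where "bij_betw k X Y" "\<And>x. x \<in> X \<Longrightarrow> h (i x) = j (k x)"
proof
  have bij: "bij_betw (\<lambda>x. h (i x)) X (j ` Y)" "bij_betw j Y (j ` Y)"
    using assms by (auto simp: bij_betw_def inj_on_def image_image)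
  show "bij_betw (inv_into Y j \<circ> (\<lambda>x. h (i x))) X Y"
    using bij_betw_trans[OF bij(1) bij_betw_inv_into[OF bij(2)]] .
  show "h (i x) = j ((inv_into Y j \<circ> (\<lambda>x. h (i x))) x)" if "x \<in> X" for x
  proof -
    have "h (i x) \<in> j ` Y"
      using that assms(4) by blast
    then show ?thesis
      by (simp add: f_inv_into_f)
  qed
qed

text \<open>The isomorphism induces bijections of \<open>T\<^sup>0\<close>, of the relations and of the vertices, as these are given
  by isomorphism invariants. The bijection of \<open>T\<^sup>0\<close> is the image map of the bijection of vertices,
  because membership \<open>v \<in> A\<close> is expressed by \<open>{v} A \<noteq> 0\<close>.\<close>

lemma network_isomorphic_of_semigroup_iso:
  assumes net: "network \<Gamma>" "network \<Delta>"
    and iso: "network_semigroup \<Gamma> \<cong> network_semigroup \<Delta>"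
  shows "network_isomorphic \<Gamma> \<Delta>"
proof -
  interpret \<Gamma>: network \<Gamma> by fact
  interpret \<Delta>: network \<Delta> by fact
  obtain h where h: "h \<in> iso \<Gamma>.Q \<Delta>.Q"
    using iso by (auto simp: is_iso_def)
  note closed = network_semigroup_closed[of _ \<Gamma>]
  note mult = iso_mult[OF h closed, simplified] and absorbing = iso_absorbing[OF h closed, simplified]
  have inj: "inj_on h (carrier \<Gamma>.Q)"
    using h by (simp add: iso_def bij_betw_def)
  have obj_carrier: "\<Gamma>.obj A \<in> carrier \<Gamma>.Q" if "A \<in> rels0 \<Gamma>" for A
    using that by (simp add: word_class_closed)
  have arr_carrier: "\<Gamma>.arr t \<in> carrier \<Gamma>.Q" if "t \<in> rels \<Gamma>" for t
    using that by (simp add: word_class_closed)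
  have inj_obj: "inj_on h (\<Gamma>.obj ` rels0 \<Gamma>)" and inj_arr: "inj_on h (\<Gamma>.arr ` rels \<Gamma>)"
    using obj_carrier arr_carrier by (auto intro: inj_on_subset[OF inj])
  have "h ` \<Gamma>.obj ` rels0 \<Gamma> = \<Delta>.obj ` rels0 \<Delta>"
    using iso_left_rigid[OF h closed] by (simp add: \<Gamma>.left_rigid_eq \<Delta>.left_rigid_eq)
  then obtain \<alpha> where \<alpha>: "bij_betw \<alpha> (rels0 \<Gamma>) (rels0 \<Delta>)"
    and h_obj: "\<And>A. A \<in> rels0 \<Gamma> \<Longrightarrow> h (\<Gamma>.obj A) = \<Delta>.obj (\<alpha> A)"
    using bij_betw_transport[OF inj_obj \<Gamma>.obj_inj \<Delta>.obj_inj] by metis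
  have "h ` \<Gamma>.arr ` rels \<Gamma> = \<Delta>.arr ` rels \<Delta>"
    using iso_prime_paths[OF h closed] by (simp add: \<Gamma>.prime_paths_eq \<Delta>.prime_paths_eq)
  then obtain g where g: "bij_betw g (rels \<Gamma>) (rels \<Delta>)"
    and h_arr: "\<And>t. t \<in> rels \<Gamma> \<Longrightarrow> h (\<Gamma>.arr t) = \<Delta>.arr (g t)"
    using bij_betw_transport[OF inj_arr \<Gamma>.arr_inj \<Delta>.arr_inj] by metis
  have inj_vert: "inj_on (\<lambda>v. \<Gamma>.obj {v}) (verts \<Gamma>)" "inj_on (\<lambda>w. \<Delta>.obj {w}) (verts \<Delta>)"
    using \<Gamma>.obj_inj \<Delta>.obj_inj by (blast intro!: inj_onI dest: inj_onD)+
  have inj_vert': "inj_on h ((\<lambda>v. \<Gamma>.obj {v}) ` verts \<Gamma>)"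
    using inj_obj by (rule inj_on_subset) auto
  have "h ` (\<lambda>v. \<Gamma>.obj {v}) ` verts \<Gamma> = (\<lambda>w. \<Delta>.obj {w}) ` verts \<Delta>"
    using iso_atomic_rigid[OF h closed] by (simp add: \<Gamma>.atomic_rigid_eq \<Delta>.atomic_rigid_eq)
  then obtain f where f: "bij_betw f (verts \<Gamma>) (verts \<Delta>)"
    and h_vert: "\<And>v. v \<in> verts \<Gamma> \<Longrightarrow> h (\<Gamma>.obj {v}) = \<Delta>.obj {f v}"
    using bij_betw_transport[OF inj_vert' inj_vert] by metis
  have f_verts: "f v \<in> verts \<Delta>" if "v \<in> verts \<Gamma>" for v
    using f that by (rule bij_betwE[rule_format])
  have \<alpha>_rels0: "\<alpha> A \<in> rels0 \<Delta>" if "A \<in> rels0 \<Gamma>" for A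
    using bij_betwE[OF \<alpha>] that by blast
  have g_rels: "g t \<in> rels \<Delta>" if "t \<in> rels \<Gamma>" for t
    using bij_betwE[OF g] that by blast
  have incidence: "f v \<in> \<alpha> A \<longleftrightarrow> v \<in> A" if "v \<in> verts \<Gamma>" "A \<in> rels0 \<Gamma>" for v A
  proof -
    have "h (\<Gamma>.obj {v} \<otimes>\<^bsub>\<Gamma>.Q\<^esub> \<Gamma>.obj A) = \<Delta>.obj {f v} \<otimes>\<^bsub>\<Delta>.Q\<^esub> \<Delta>.obj (\<alpha> A)"
      using that mult[of "\<Gamma>.obj {v}" "\<Gamma>.obj A"]
      by (simp add: obj_carrier h_obj[OF that(2)] h_vert[OF that(1)])
    then have "absorbing \<Delta>.Q (\<Delta>.obj {f v} \<otimes>\<^bsub>\<Delta>.Q\<^esub> \<Delta>.obj (\<alpha> A)) \<longleftrightarrow>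
        absorbing \<Gamma>.Q (\<Gamma>.obj {v} \<otimes>\<^bsub>\<Gamma>.Q\<^esub> \<Gamma>.obj A)"
      using absorbing[of "\<Gamma>.obj {v} \<otimes>\<^bsub>\<Gamma>.Q\<^esub> \<Gamma>.obj A"] closed that by (simp add: obj_carrier)
    then show ?thesis
      using that by (simp add: \<Gamma>.obj_mult_obj_absorbing_iff \<Delta>.obj_mult_obj_absorbing_iff \<alpha>_rels0 f_verts)
  qed
  have \<alpha>_image: "\<alpha> A = f ` A" if A: "A \<in> rels0 \<Gamma>" for A
  proof (intro subset_antisym subsetI)
    fix w assume w: "w \<in> \<alpha> A"
    then have "w \<in> verts \<Delta>"
      using \<Delta>.rels0_subset[OF \<alpha>_rels0[OF A]] by blast
    then obtain v where "v \<in> verts \<Gamma>" "w = f v"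
      using bij_betw_imp_surj_on[OF f] by blast
    then show "w \<in> f ` A"
      using incidence A w by blast
  next
    fix w assume "w \<in> f ` A"
    then show "w \<in> \<alpha> A"
      using incidence A \<Gamma>.rels0_subset[OF A] by blast
  qed
  have "f ` src \<Gamma> t = src \<Delta> (g t) \<and> f ` rng \<Gamma> t = rng \<Delta> (g t)" if t: "t \<in> rels \<Gamma>" for t
  proof
    have "\<Delta>.obj (\<alpha> (src \<Gamma> t)) \<otimes>\<^bsub>\<Delta>.Q\<^esub> \<Delta>.arr (g t) = \<Delta>.arr (g t)"
      using t mult[of "\<Gamma>.obj (src \<Gamma> t)" "\<Gamma>.arr t"]
      by (simp add: obj_carrier arr_carrier h_obj h_arr \<Gamma>.obj_mult_arr_iff[THEN iffD2])
    then show "f ` src \<Gamma> t = src \<Delta> (g t)"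
      using t by (simp add: \<Delta>.obj_mult_arr_iff \<alpha>_rels0 g_rels \<alpha>_image[symmetric])
    have "\<Delta>.arr (g t) \<otimes>\<^bsub>\<Delta>.Q\<^esub> \<Delta>.obj (\<alpha> (rng \<Gamma> t)) = \<Delta>.arr (g t)"
      using t mult[of "\<Gamma>.arr t" "\<Gamma>.obj (rng \<Gamma> t)"]
      by (simp add: obj_carrier arr_carrier h_obj h_arr \<Gamma>.arr_mult_obj_iff[THEN iffD2])
    then show "f ` rng \<Gamma> t = rng \<Delta> (g t)"
      using t by (simp add: \<Delta>.arr_mult_obj_iff \<alpha>_rels0 g_rels \<alpha>_image[symmetric])
  qed
  then have "network_hom \<Gamma> \<Delta> f g"
    using f_verts g_rels by (simp add: network_hom_def)
  then show ?thesis
    using f g by (auto simp: network_isomorphic_def)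
qed

theorem theorem5p2:
  fixes \<Gamma> :: "('v, 't) network_data" and \<Delta> :: "('w, 'u) network_data"
  assumes "network \<Gamma>" and "network \<Delta>"
  shows "network_isomorphic \<Gamma> \<Delta> \<longleftrightarrow> network_semigroup \<Gamma> \<cong> network_semigroup \<Delta>"
  using network_semigroup_iso network_isomorphic_of_semigroup_iso assms by blast

end
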